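(* Let $n > 1$ be odd. Let $\gamma_3(n) = 1$ if $n$ is a multiple of $3$, and $\gamma_3(n)=0$ otherwise; let $\delta_3(n) = 1$ if $n$ has a prime factor $p > 3$ with $p \equiv 3 \pmod 4$, and $\delta_3(n)=0$ otherwise; and let $\gamma_5(n)=1$ if $n$ is a multiple of $5$, and $\gamma_5(n)=0$ otherwise. Then $$\mathrm{diam}(G_n) = \begin{cases} 1, & \text{if } n \text{ is prime and } n \equiv 3 \pmod 4;\\ 2, & \text{if } n \text{ is prime and } n\equiv 1 \pmod 4;\\ 2, & \text{if } \omega(n)=1 \text{ and } n \text{ is composite};\\ 2 + \gamma_3(n)\delta_3(n) + \gamma_5(n), & \text{if } \omega(n) > 1.\end{cases}$$ In particular, $\mathrm{diam}(G_n) \le 4$.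
   Context: For an integer $n \ge 1$, $Q_n = \{u^2 : u \in \mathbb{Z}_n^\times\}$ and $T_n = \pm Q_n = \{\pm u^2 : u \in \mathbb{Z}_n^\times\}$. The quadratic unitary Cayley graph $G_n = \mathrm{Cay}(\mathbb{Z}_n, T_n)$ is the undirected graph with vertex set $\mathbb{Z}_n$ in which $a,b$ are adjacent iff $a-b \in T_n$. $\mathrm{diam}$ denotes the graph diameter, and $\omega(n)$ the number of distinct prime factors of $n$. *)

theory Defs
  imports "HOL-Number_Theory.Number_Theory" "Graph_Theory.Graph_Theory"
begin

text \<open>
  The distance is the least number of arcs on a walk, that is, the library's shortest path cost
  \<open>\<mu>\<close> for unit weights. It is \<open>\<infinity>\<close> if there is no walk, so the diameter of a nonempty
  graph is finite only if the graph is (strongly) connected.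
\<close>
definition (in wf_digraph) diameter :: ereal where
  "diameter = (SUP u\<in>verts G. SUP v\<in>verts G. \<mu> (\<lambda>_. 1) u v)"

text \<open>
  An undirected simple graph is represented by the symmetric set of arcs containing each edge
  in both orientations.
\<close>
definition cayley_graph :: "('a, 'm) ring_scheme \<Rightarrow> 'a set \<Rightarrow> 'a pair_pre_digraph" where
  "cayley_graph R S =
     \<lparr>pverts = carrier R, parcs = {(a, b) \<in> carrier R \<times> carrier R. a \<ominus>\<^bsub>R\<^esub> b \<in> S}\<rparr>"

text \<open>
  The modulus must be greater than \<open>1\<close>: \<open>residue_ring 1\<close> is not a ring, as its one
  is not in its carrier.
\<close>
abbreviation Zmod :: "nat \<Rightarrow> int ring" where
  "Zmod n \<equiv> residue_ring (int n)"

definition unit_squares :: "nat \<Rightarrow> int set" where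
  "unit_squares n = {u [^]\<^bsub>Zmod n\<^esub> (2::nat) | u. u \<in> Units (Zmod n)}"

definition pm_unit_squares :: "nat \<Rightarrow> int set" where
  "pm_unit_squares n = unit_squares n \<union> {\<ominus>\<^bsub>Zmod n\<^esub> q | q. q \<in> unit_squares n}"

definition quad_unitary_cayley_graph :: "nat \<Rightarrow> int pair_pre_digraph" where
  "quad_unitary_cayley_graph n = cayley_graph (Zmod n) (pm_unit_squares n)"

definition diam_G :: "nat \<Rightarrow> ereal" where
  "diam_G n = wf_digraph.diameter (with_proj (quad_unitary_cayley_graph n))"

definition omega :: "nat \<Rightarrow> nat" where
  "omega n = card (prime_factors n)"

definition gamma3 :: "nat \<Rightarrow> nat" where
  "gamma3 n = (if 3 dvd n then 1 else 0)"

definition delta3 :: "nat \<Rightarrow> nat" where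
  "delta3 n = (if \<exists>p. prime p \<and> p dvd n \<and> p > 3 \<and> [p = 3] (mod 4) then 1 else 0)"

definition gamma5 :: "nat \<Rightarrow> nat" where
  "gamma5 n = (if 5 dvd n then 1 else 0)"

text \<open>
  These are finite simple undirected graphs, so \<open>wf_digraph.diameter_def\<close> applies to them.
\<close>
lemma pair_graph_quad_unitary_cayley_graph:
  assumes "n > 1"
  shows "pair_graph (quad_unitary_cayley_graph n)"
proof -
  interpret residues "int n" "Zmod n"
    using assms by unfold_locales auto
  have fin: "finite (carrier (Zmod n))"
    by (simp add: res_carrier_eq)
  have sq: "q \<in> Units (Zmod n)" if "q \<in> unit_squares n" for q
    using that unfolding unit_squares_def by (auto simp: numeral_2_eq_2)
  have neg_Units: "\<ominus>\<^bsub>Zmod n\<^esub> q \<in> Units (Zmod n)" if "q \<in> Units (Zmod n)" for q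
  proof -
    obtain r where "r \<in> carrier (Zmod n)" "q \<otimes>\<^bsub>Zmod n\<^esub> r = \<one>\<^bsub>Zmod n\<^esub>"
      using Units_r_inv_ex[OF \<open>q \<in> _\<close>] by auto
    then have "\<ominus>\<^bsub>Zmod n\<^esub> q \<otimes>\<^bsub>Zmod n\<^esub> \<ominus>\<^bsub>Zmod n\<^esub> r = \<one>\<^bsub>Zmod n\<^esub>"
      using Units_closed[OF that] by (simp add: l_minus r_minus)
    then show ?thesis
      using that \<open>r \<in> _\<close> unfolding Units_def
      by (auto simp: m_comm intro!: bexI[of _ "\<ominus>\<^bsub>Zmod n\<^esub> r"])
  qed
  have T_Units: "t \<in> Units (Zmod n)" if "t \<in> pm_unit_squares n" for t
    using that sq neg_Units unfolding pm_unit_squares_def by auto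
  have zero: "\<zero>\<^bsub>Zmod n\<^esub> \<notin> pm_unit_squares n"
  proof
    assume "\<zero>\<^bsub>Zmod n\<^esub> \<in> pm_unit_squares n"
    then obtain r where "r \<in> carrier (Zmod n)"
      "\<zero>\<^bsub>Zmod n\<^esub> \<otimes>\<^bsub>Zmod n\<^esub> r = \<one>\<^bsub>Zmod n\<^esub>"
      using T_Units Units_r_inv_ex by blast
    then have "\<zero>\<^bsub>Zmod n\<^esub> = \<one>\<^bsub>Zmod n\<^esub>"
      using l_null by metis
    then show False
      by (simp add: res_zero_eq res_one_eq)
  qed
  have neg: "\<ominus>\<^bsub>Zmod n\<^esub> t \<in> pm_unit_squares n" if "t \<in> pm_unit_squares n" for t
    using that sq unfolding pm_unit_squares_def by (auto simp: Units_closed)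
  have swap: "b \<ominus>\<^bsub>Zmod n\<^esub> a = \<ominus>\<^bsub>Zmod n\<^esub> (a \<ominus>\<^bsub>Zmod n\<^esub> b)"
    if "a \<in> carrier (Zmod n)" "b \<in> carrier (Zmod n)" for a b
    using that by (simp add: a_minus_def minus_add a_comm)
  let ?G = "quad_unitary_cayley_graph n"
  have arcs: "(a, b) \<in> parcs ?G \<longleftrightarrow>
      a \<in> pverts ?G \<and> b \<in> pverts ?G \<and> a \<ominus>\<^bsub>Zmod n\<^esub> b \<in> pm_unit_squares n" for a b
    by (auto simp: quad_unitary_cayley_graph_def cayley_graph_def)
  have verts: "pverts ?G = carrier (Zmod n)"
    by (simp add: quad_unitary_cayley_graph_def cayley_graph_def)
  have "finite (parcs ?G)"
    by (rule finite_subset[of _ "pverts ?G \<times> pverts ?G"]) (use fin arcs verts in auto)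
  moreover have "symmetric (with_proj ?G)"
    unfolding symmetric_def
  proof (rule symI)
    fix a b assume "(a, b) \<in> arcs_ends (with_proj ?G)"
    then have "(a, b) \<in> parcs ?G" by simp
    then have "(b, a) \<in> parcs ?G" using neg swap unfolding arcs verts by metis
    then show "(b, a) \<in> arcs_ends (with_proj ?G)" by simp
  qed
  moreover have "a \<noteq> b" if "(a, b) \<in> parcs ?G" for a b
    using that zero unfolding arcs verts by (auto simp: a_minus_def r_neg)
  ultimately show ?thesis
    using fin arcs verts by unfold_locales auto
qed

end

theory Submission
  imports Defs
begin

text \<open>
  A walk of length \<open>k\<close> from \<open>a\<close> to \<open>b\<close> is a representation of \<open>a - b\<close> as a sum of \<open>k\<close> signed unit
  squares modulo \<open>n\<close>. For a fixed nonempty sign pattern, Hensel lifting and the Chinese remainder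
  theorem make representability modulo \<open>n\<close> equivalent to representability modulo every prime
  \<open>p\<close> dividing \<open>n\<close>; the difficulty is that all primes must use the same signs.
  For \<open>p > 5\<close> every residue is a difference of two unit squares, every pattern of three signs
  represents everything, and so does every pattern of two signs if \<open>p \<equiv> 1 (mod 4)\<close>; but two
  equal signs never represent \<open>0\<close> if \<open>p \<equiv> 3 (mod 4)\<close>. Modulo \<open>3\<close> the only unit square is \<open>1\<close>, so the
  residue restricts the signs; modulo \<open>5\<close> the unit squares are \<open>\<plusminus>1\<close>, so two terms miss \<open>\<plusminus>1\<close> and
  three terms miss \<open>0\<close>. These obstructions yield the terms \<open>\<gamma>\<^sub>3 \<delta>\<^sub>3\<close> and \<open>\<gamma>\<^sub>5\<close>.
\<close>

section \<open>Signed sums of unit squares and the local-global principle\<close>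

text \<open>The signs are an explicit list because the local-global principle must use one and the
  same pattern at every prime, while the units may be chosen per prime. The recursion lets
  inductions fix one unit at a time.\<close>

fun unit_square_sum :: "int \<Rightarrow> int list \<Rightarrow> int \<Rightarrow> bool" where
  "unit_square_sum m [] x \<longleftrightarrow> m dvd x"
| "unit_square_sum m (s # ss) x \<longleftrightarrow> (\<exists>u. coprime u m \<and> unit_square_sum m ss (x - s * u\<^sup>2))"

lemma unit_square_sum_cong:
  assumes "[x = y] (mod m)" "unit_square_sum m ss x"
  shows "unit_square_sum m ss y"
  using assms
proof (induction ss arbitrary: x y)
  case Nil
  then show ?case by (simp add: cong_dvd_iff)
next
  case (Cons s ss)
  from Cons.prems(2) obtain u where u: "coprime u m" "unit_square_sum m ss (x - s * u\<^sup>2)"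
    by auto
  have "[x - s * u\<^sup>2 = y - s * u\<^sup>2] (mod m)"
    using Cons.prems(1) by (intro cong_diff) auto
  with Cons.IH u show ?case by auto
qed

lemma unit_square_sum_dvd_modulus:
  assumes "d dvd m" "unit_square_sum m ss x"
  shows "unit_square_sum d ss x"
  using assms
proof (induction ss arbitrary: x)
  case Nil
  then show ?case by (auto intro: dvd_trans)
next
  case (Cons s ss)
  then show ?case by (auto intro: coprime_divisors[OF dvd_refl])
qed

lemma unit_square_sum_uminus:
  "unit_square_sum m (map uminus ss) (- x) \<longleftrightarrow> unit_square_sum m ss x"
proof (induction ss arbitrary: x)
  case (Cons s ss)
  have "- x - - s * u\<^sup>2 = - (x - s * u\<^sup>2)" for u by simp
  then show ?case using Cons by (simp only: unit_square_sum.simps list.map)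
qed simp

text \<open>Each extra term gets the unit 1, and the remaining terms absorb the difference. So a
  universal pattern stays universal when it grows.\<close>

lemma unit_square_sum_append:
  assumes "\<And>y. unit_square_sum m ss y"
  shows "unit_square_sum m (ts @ ss) x"
proof (induction ts arbitrary: x)
  case (Cons t ts)
  then show ?case by (auto intro: exI[of _ 1])
qed (simp add: assms)

text \<open>Multiply every unit by \<open>c\<close>. Hence representability depends only on the
  class of \<open>x\<close> up to unit squares.\<close>

lemma unit_square_sum_scale:
  assumes "coprime c m" "unit_square_sum m ss x"
  shows "unit_square_sum m ss (c\<^sup>2 * x)"
  using assms(2)
proof (induction ss arbitrary: x)
  case (Cons s ss)
  then obtain u where u: "coprime u m" "unit_square_sum m ss (x - s * u\<^sup>2)"
    by auto
  from Cons.IH[OF u(2)] have "unit_square_sum m ss (c\<^sup>2 * x - s * (c * u)\<^sup>2)"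
    by (simp add: algebra_simps)
  moreover have "coprime (c * u) m" using u(1) assms(1) by simp
  ultimately show ?case unfolding unit_square_sum.simps by blast
qed simp

section \<open>Square roots by Chinese remaindering and Hensel lifting\<close>

lemma chinese_remainder_primes_int:
  fixes u :: "int \<Rightarrow> int"
  assumes "finite P" "\<And>p. p \<in> P \<Longrightarrow> prime p"
  shows "\<exists>x. \<forall>p\<in>P. [x = u p] (mod p)"
  using assms
proof (induction P rule: finite_induct)
  case (insert q P)
  then obtain y where y: "\<forall>p\<in>P. [y = u p] (mod p)" by auto
  have "coprime q (\<Prod>P)"
    using insert by (intro prod_coprime_right) (auto intro: primes_coprime)
  then obtain x where x: "[x = u q] (mod q)" "[x = y] (mod \<Prod>P)"
    using binary_chinese_remainder_int by blast
  have "[x = u p] (mod p)" if "p \<in> P" for p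
    using y that x(2) insert.hyps(1) by (meson cong_dvd_modulus cong_trans dvd_prodI)
  with x(1) show ?case by auto
qed simp

text \<open>Hensel step for a prime already dividing \<open>m\<close>. If u^2 - t = m c, replacing u
  by u + m k changes the error to m (2 u k + c) + m^2 k^2. As 2 u is invertible modulo
  \<open>p\<close>, some k makes the first summand divisible by p m; the second one is since
  \<open>p\<close> divides \<open>m\<close>.\<close>

lemma QuadRes_lift_prime:
  assumes p: "prime p" "p dvd m" "coprime (2 * t) m" and "QuadRes m t"
  shows "QuadRes (p * m) t"
proof -
  obtain u where "[u\<^sup>2 = t] (mod m)" using assms by (auto simp: QuadRes_def)
  then obtain c where c: "u\<^sup>2 - t = m * c"
    by (auto simp: cong_iff_dvd_diff)
  have "coprime (2 * t) p" using p coprime_divisors[OF dvd_refl] by blast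
  moreover have "[t = u\<^sup>2] (mod p)"
    using c p(2) by (metis cong_iff_dvd_diff cong_sym dvd_mult2)
  ultimately have "coprime (2 * u\<^sup>2) p"
    by (metis cong_imp_coprime cong_scalar_left)
  then have "coprime (2 * u) p" by simp
  then obtain k where "[2 * u * k = - c] (mod p)"
    by (metis cong_solve_coprime_int cong_scalar_left mult.assoc mult.commute mult_1)
  then obtain d where d: "2 * u * k + c = p * d" by (auto simp: cong_iff_dvd_diff)
  obtain e where e: "m = p * e" using p(2) by auto
  have "(u + m * k)\<^sup>2 - t = m * (2 * u * k + c) + m * m * k\<^sup>2"
    using c by (simp add: power2_eq_square algebra_simps)
  also have "\<dots> = p * m * (d + e * k\<^sup>2)"
    by (simp add: d) (simp add: e algebra_simps)
  finally show ?thesis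
    unfolding QuadRes_def cong_iff_dvd_diff by (metis dvd_triv_left)
qed

lemma QuadRes_mult_coprime:
  assumes "coprime a b" "QuadRes a t" "QuadRes b t"
  shows "QuadRes (a * b) t"
proof -
  obtain u v where uv: "[u\<^sup>2 = t] (mod a)" "[v\<^sup>2 = t] (mod b)"
    using assms by (auto simp: QuadRes_def)
  obtain w where "[w = u] (mod a)" "[w = v] (mod b)"
    using binary_chinese_remainder_int assms(1) by blast
  then have "[w\<^sup>2 = t] (mod a)" "[w\<^sup>2 = t] (mod b)"
    using uv by (metis cong_pow cong_trans)+
  then show ?thesis using assms(1) by (metis QuadRes_def coprime_cong_mult)
qed

text \<open>Build \<open>m\<close> up one prime at a time: a repeated prime is a Hensel step, a new
  prime is handled by Chinese remaindering.\<close>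

lemma QuadRes_if_prime_divisors:
  assumes "m \<noteq> 0" "coprime (2 * t) m" "\<And>p. prime p \<Longrightarrow> p dvd m \<Longrightarrow> QuadRes p t"
  shows "QuadRes m t"
  using assms
proof (induction m rule: prime_divisors_induct)
  case (unit m)
  then show ?case unfolding QuadRes_def cong_iff_dvd_diff by (blast intro: unit_imp_dvd)
next
  case (factor p m)
  then have "QuadRes m t" by auto
  show ?case
  proof (cases "p dvd m")
    case True
    with factor \<open>QuadRes m t\<close> show ?thesis
      by (intro QuadRes_lift_prime) auto
  next
    case False
    with factor \<open>QuadRes m t\<close> show ?thesis
      by (intro QuadRes_mult_coprime) (auto intro: prime_imp_coprime)
  qed
qed simp

lemma coprime_if_prime_divisors:
  fixes m :: int
  assumes "m \<noteq> 0" "\<And>p. prime p \<Longrightarrow> p dvd m \<Longrightarrow> \<not> p dvd x"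
  shows "coprime x m"
proof (rule ccontr)
  assume "\<not> coprime x m"
  then have "\<not> is_unit (gcd x m)" by (metis is_unit_gcd)
  moreover have "gcd x m \<noteq> 0" using \<open>m \<noteq> 0\<close> by simp
  ultimately obtain p where "p dvd gcd x m" "prime p" using prime_divisor_exists by blast
  with assms(2) show False by (meson dvd_trans gcd_dvd1 gcd_dvd2)
qed

text \<open>Since s * s = 1, the claim says that s x is a unit square modulo \<open>m\<close>. The
  local solutions make s x a unit and a square modulo each prime divisor, so square roots can be
  lifted.\<close>

lemma unit_square_sum_lift_single:
  assumes "odd m" and s: "s \<in> {1, -1}"
    and loc: "\<And>p. prime p \<Longrightarrow> p dvd m \<Longrightarrow> unit_square_sum p [s] x"
  shows "unit_square_sum m [s] x"
proof -
  have "m \<noteq> 0" using \<open>odd m\<close> by auto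
  have ss: "s * s = 1" using s by auto
  have loc': "\<exists>u. coprime u p \<and> [u\<^sup>2 = s * x] (mod p)" if p: "prime p" "p dvd m" for p
  proof -
    obtain u where u: "coprime u p" "p dvd x - s * u\<^sup>2" using loc[OF p] by auto
    have "s * x - u\<^sup>2 = s * (x - s * u\<^sup>2)" using ss by (simp add: algebra_simps flip: mult.assoc)
    then show ?thesis using u by (metis cong_iff_dvd_diff cong_sym dvd_mult)
  qed
  have "coprime (s * x) m"
  proof (rule coprime_if_prime_divisors[OF \<open>m \<noteq> 0\<close>])
    fix p :: int assume p: "prime p" "p dvd m"
    then obtain u where u: "coprime u p" "[u\<^sup>2 = s * x] (mod p)" using loc' by blast
    then have "coprime (s * x) p" by (metis cong_imp_coprime coprime_power_left_iff)
    then show "\<not> p dvd s * x" using p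
      by (metis coprime_absorb_right not_prime_unit)
  qed
  moreover have "coprime 2 m" using \<open>odd m\<close> by simp
  ultimately have cop: "coprime (2 * (s * x)) m" by (simp only: coprime_mult_left_iff)
  have "QuadRes m (s * x)"
  proof (rule QuadRes_if_prime_divisors[OF \<open>m \<noteq> 0\<close> cop])
    fix p :: int assume "prime p" "p dvd m"
    from loc'[OF this] show "QuadRes p (s * x)" unfolding QuadRes_def by blast
  qed
  then obtain u where u: "[u\<^sup>2 = s * x] (mod m)" by (auto simp: QuadRes_def)
  with cop have "coprime (u\<^sup>2) m" by (metis cong_imp_coprime cong_sym coprime_mult_left_iff)
  moreover have "x - s * u\<^sup>2 = s * (s * x - u\<^sup>2)" using ss by (simp add: algebra_simps flip: mult.assoc)
  ultimately show ?thesis using u by (auto simp: cong_iff_dvd_diff dvd_diff_commute intro!: exI[of _ u])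
qed

text \<open>All units except the last need only be right modulo each prime: they are glued by
  Chinese remaindering and then fixed. The last term must match exactly modulo \<open>m\<close>, and
  only there is Hensel lifting used. With no terms at all, divisibility by the primes would not give
  divisibility by \<open>m\<close>.\<close>

lemma unit_square_sum_local_global:
  assumes "odd m" "ss \<noteq> []" "set ss \<subseteq> {1, -1}"
    and loc: "\<And>p. prime p \<Longrightarrow> p dvd m \<Longrightarrow> unit_square_sum p ss x"
  shows "unit_square_sum m ss x"
  using assms(2-)
proof (induction ss arbitrary: x rule: induct_list012)
  case (2 s)
  then show ?case using unit_square_sum_lift_single[OF \<open>odd m\<close>] by simp
next
  case (3 s s' ss)
  have "m \<noteq> 0" using \<open>odd m\<close> by auto
  let ?P = "{p. prime p \<and> p dvd m}"
  have "\<forall>p\<in>?P. \<exists>u. coprime u p \<and> unit_square_sum p (s' # ss) (x - s * u\<^sup>2)"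
    using "3.prems"(3) by simp
  then obtain v where v: "\<forall>p\<in>?P. coprime (v p) p \<and> unit_square_sum p (s' # ss) (x - s * (v p)\<^sup>2)"
    by (metis (no_types, lifting))
  have "finite ?P"
    using finite_divisors_int[OF \<open>m \<noteq> 0\<close>] by (rule rev_finite_subset) auto
  then obtain u where u: "\<forall>p\<in>?P. [u = v p] (mod p)"
    using chinese_remainder_primes_int[of ?P v] by blast
  have "coprime u m"
  proof (rule coprime_if_prime_divisors[OF \<open>m \<noteq> 0\<close>])
    fix p :: int assume p: "prime p" "p dvd m"
    then have "coprime u p" using u v cong_imp_coprime cong_sym by blast
    then show "\<not> p dvd u" using p
      by (metis coprime_absorb_right not_prime_unit)
  qed
  moreover have "unit_square_sum m (s' # ss) (x - s * u\<^sup>2)"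
  proof (rule "3.IH"(2))
    fix p :: int assume p: "prime p" "p dvd m"
    then have "[x - s * (v p)\<^sup>2 = x - s * u\<^sup>2] (mod p)"
      using u by (intro cong_diff cong_mult cong_pow) (auto simp: cong_sym)
    then show "unit_square_sum p (s' # ss) (x - s * u\<^sup>2)"
      using v p unit_square_sum_cong by blast
  qed (use "3.prems" in auto)
  ultimately show ?case by auto
qed simp

section \<open>Signed sums of unit squares modulo a prime\<close>

lemma unit_square_sum_sum_list:
  assumes "[x = sum_list ss] (mod m)"
  shows "unit_square_sum m ss x"
  using assms
proof (induction ss arbitrary: x)
  case (Cons s ss)
  then have "[x - s = sum_list ss] (mod m)"
    by (simp add: cong_iff_dvd_diff algebra_simps)
  with Cons.IH show ?case by (auto intro: exI[of _ 1])
qed (simp add: cong_0_iff)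

lemma unit_square_sum_two:
  assumes "coprime a m" "coprime b m"
  shows "unit_square_sum m [s, t] (s * a\<^sup>2 + t * b\<^sup>2)"
proof -
  have "unit_square_sum m [] (s * a\<^sup>2 + t * b\<^sup>2 - s * a\<^sup>2 - t * b\<^sup>2)" by simp
  with assms show ?thesis unfolding unit_square_sum.simps by blast
qed

text \<open>A square root i of -1 absorbs a sign into the unit: s u^2 = - s (i u)^2.\<close>

lemma unit_square_sum_change_signs:
  assumes "coprime i m" "[i\<^sup>2 = -1] (mod m)"
    and "length ss = length ts" "set ss \<subseteq> {1, -1}" "set ts \<subseteq> {1, -1}"
    and "unit_square_sum m ss x"
  shows "unit_square_sum m ts x"
  using assms(3-)
proof (induction ss ts arbitrary: x rule: list_induct2)
  case (Cons s ss t ts)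
  then obtain u where u: "coprime u m" "unit_square_sum m ss (x - s * u\<^sup>2)" by auto
  have IH: "unit_square_sum m ts (x - s * u\<^sup>2)" using Cons u by auto
  show ?case
  proof (cases "s = t")
    case True
    with IH u show ?thesis by auto
  next
    case False
    with Cons.prems have t: "t = - s" by auto
    have "[x - t * (i\<^sup>2 * u\<^sup>2) = x - t * (- 1 * u\<^sup>2)] (mod m)"
      using assms(2) by (intro cong_diff cong_mult cong_refl)
    then have "[x - s * u\<^sup>2 = x - t * (i * u)\<^sup>2] (mod m)"
      by (simp add: t power_mult_distrib cong_sym)
    then have "unit_square_sum m ts (x - t * (i * u)\<^sup>2)"
      using IH unit_square_sum_cong by blast
    moreover have "coprime (i * u) m" using assms(1) u(1) by simp
    ultimately show ?thesis unfolding unit_square_sum.simps by blast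
  qed
qed simp

text \<open>If r = s c^2 and x = s w^2, then x = (w / c)^2 r, so scaling applies. One represented
  element thus gives its whole class modulo unit squares.\<close>

lemma unit_square_sum_class:
  assumes "unit_square_sum m ss r" "coprime c m" "coprime w m"
    and "[r = s * c\<^sup>2] (mod m)" "[x = s * w\<^sup>2] (mod m)"
  shows "unit_square_sum m ss x"
proof -
  obtain d where d: "[c * d = 1] (mod m)" using assms(2) cong_solve_coprime_int by blast
  then have "coprime d m" by (metis cong_imp_coprime cong_sym coprime_1_left coprime_mult_left_iff)
  then have "unit_square_sum m ss ((w * d)\<^sup>2 * r)"
    using assms by (intro unit_square_sum_scale) auto
  moreover have "[(w * d)\<^sup>2 * r = x] (mod m)"
  proof -
    have "[(w * d)\<^sup>2 * r = (w * d)\<^sup>2 * (s * c\<^sup>2)] (mod m)"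
      using assms(4) by (intro cong_mult) auto
    also have "(w * d)\<^sup>2 * (s * c\<^sup>2) = s * w\<^sup>2 * (c * d)\<^sup>2"
      by (simp add: power_mult_distrib)
    also have "[\<dots> = s * w\<^sup>2 * 1\<^sup>2] (mod m)"
      using d by (intro cong_mult cong_pow) auto
    also have "[s * w\<^sup>2 * 1\<^sup>2 = x] (mod m)" using assms(5) by (simp add: cong_sym)
    finally show ?thesis .
  qed
  ultimately show ?thesis using unit_square_sum_cong by blast
qed

section \<open>Differences of two unit squares modulo p > 5\<close>

text \<open>The numbers 3, 5 and 8 are the differences of the squares 1, 4, 9, which therefore stay
  distinct modulo \<open>p\<close>.\<close>

lemma prime_gt_5_not_dvd:
  fixes p :: int
  assumes "prime p" "p > 5"
  shows "\<not> p dvd 2" "\<not> p dvd 3" "\<not> p dvd 5" "\<not> p dvd 8" "coprime 2 p"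
proof -
  show 2: "\<not> p dvd 2" and "\<not> p dvd 3" and "\<not> p dvd 5"
    using assms by (auto dest: zdvd_imp_le)
  have "\<not> p dvd 2 ^ 3" using assms(1) 2 by (metis prime_dvd_power)
  then show "\<not> p dvd 8" by simp
  show "coprime 2 p" using assms(1) 2 by (metis prime_imp_coprime coprime_commute)
qed

(* x = a^2 - b^2 is solved by a - b = d, a + b = x / d; both a and b are units unless d^2 = x or
   d^2 = -x, and this fails for some d in {1, 2, 3} as the squares 1, 4, 9 are distinct modulo p. *)
lemma unit_square_sum_plus_minus:
  assumes p: "prime p" "p > 5"
  shows "unit_square_sum p [1, -1] x"
proof (cases "p dvd x")
  case True
  then show ?thesis
    by (intro unit_square_sum_sum_list) (simp add: cong_0_iff)
next
  case False
  have "\<exists>d\<in>{1, 2, 3}. \<not> p dvd d\<^sup>2 - x \<and> \<not> p dvd d\<^sup>2 + x"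
  proof (rule ccontr)
    assume "\<not> ?thesis"
    then have "p dvd 1 - x \<or> p dvd 1 + x" "p dvd 4 - x \<or> p dvd 4 + x" "p dvd 9 - x \<or> p dvd 9 + x"
      by auto
    \<comment> \<open>By pigeonhole, two of 1, 4, 9 would be congruent to the same one of x and -x,
      so \<open>p\<close> would divide their difference.\<close>
    then have "p dvd 3 \<or> p dvd 5 \<or> p dvd 8"
      using dvd_diff[of p "4 - x" "1 - x"] dvd_diff[of p "9 - x" "1 - x"] dvd_diff[of p "9 - x" "4 - x"]
        dvd_diff[of p "4 + x" "1 + x"] dvd_diff[of p "9 + x" "1 + x"] dvd_diff[of p "9 + x" "4 + x"]
      by auto
    then show False using prime_gt_5_not_dvd[OF p] by blast
  qed
  then obtain d where d: "d \<in> {1, 2, 3}" "\<not> p dvd d\<^sup>2 - x" "\<not> p dvd d\<^sup>2 + x" by blast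
  have "\<not> p dvd d" using d(1) p prime_gt_5_not_dvd[OF p] not_prime_unit by auto
  then have "coprime (2 * d) p"
    using p prime_gt_5_not_dvd(5)[OF p] by (metis coprime_mult_left_iff prime_imp_coprime coprime_commute)
  \<comment> \<open>With \<open>e\<close> the inverse of 2 d, solving a - b = d and a + b = x / d
    gives a = e (d^2 + x) and b = - e (d^2 - x).\<close>
  then obtain e where e: "[2 * d * e = 1] (mod p)" using cong_solve_coprime_int by blast
  then have "coprime e p" by (metis cong_imp_coprime cong_sym coprime_1_left coprime_mult_left_iff)
  moreover have "coprime (d\<^sup>2 + x) p" "coprime (d\<^sup>2 - x) p"
    using d p by (metis prime_imp_coprime coprime_commute)+
  ultimately have "coprime (e * (d\<^sup>2 + x)) p" "coprime (e * (d\<^sup>2 - x)) p" by auto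
  moreover have "unit_square_sum p [] (x - 1 * (e * (d\<^sup>2 + x))\<^sup>2 - - 1 * (e * (d\<^sup>2 - x))\<^sup>2)"
  proof -
    have "p dvd (2 * d * e - 1) * (- (2 * d * e + 1) * x)"
      using e by (metis cong_iff_dvd_diff dvd_mult2)
    also have "\<dots> = x - 1 * (e * (d\<^sup>2 + x))\<^sup>2 - - 1 * (e * (d\<^sup>2 - x))\<^sup>2"
      by (simp add: power2_eq_square algebra_simps)
    finally show ?thesis by simp
  qed
  ultimately show ?thesis unfolding unit_square_sum.simps by blast
qed

section \<open>Quadratic residues and sums of equal signs\<close>

text \<open>Euler's criterion evaluates the Legendre symbol of -1 as (-1)^k for p = 2 k + 1, and k
  is even exactly if p is 1 mod 4.\<close>

lemma QuadRes_minus_one_iff: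
  fixes p :: int
  assumes p: "prime p" "p > 2"
  shows "QuadRes p (-1) \<longleftrightarrow> [p = 1] (mod 4)"
proof -
  define q where "q = nat p"
  have q: "prime q" "q > 2" "p = int q" using p unfolding q_def by auto
  have nz: "\<not> [1 = 0] (mod p)" "\<not> [-1 = 0] (mod p)" "\<not> [1 = -1] (mod p)" "\<not> [-1 = 1] (mod p)"
    using p by (auto simp: cong_iff_dvd_diff dest: zdvd_imp_le)
  have E: "[Legendre (-1) p = (-1) ^ ((q - 1) div 2)] (mod p)"
    using euler_criterion[OF q(1,2)] q(3) by simp
  have "odd q" using q prime_odd_nat by blast
  then obtain k where k: "q = 2 * k + 1" by (auto elim: oddE)
  have "[p = 1] (mod 4) \<longleftrightarrow> even k"
    unfolding q(3) k cong_iff_dvd_diff by (auto elim!: evenE dvdE) presburger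
  moreover have "QuadRes p (-1) \<longleftrightarrow> even k"
    using E nz k by (cases "even k"; cases "QuadRes p (-1)"; simp add: Legendre_def)
  ultimately show ?thesis by simp
qed

text \<open>Write p = 2 k + 1 with k odd. If both x and -x were nonresidues, Euler's criterion would
  give x^k = (-x)^k = -1; but these powers sum to 0, forcing \<open>p\<close> to divide 2.\<close>

lemma QuadRes_or_uminus:
  fixes p :: int
  assumes p: "prime p" "[p = 3] (mod 4)"
  shows "QuadRes p x \<or> QuadRes p (- x)"
proof (rule ccontr)
  assume *: "\<not> ?thesis"
  define q where "q = nat p"
  have "p > 2"
    using p(2) prime_ge_2_int[OF p(1)] unfolding cong_iff_dvd_diff by presburger
  have q: "prime q" "q > 2" "p = int q" using p \<open>p > 2\<close> unfolding q_def by auto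
  have nz: "\<not> [x = 0] (mod p)" "\<not> [- x = 0] (mod p)"
    using * by (metis QuadRes_def cong_sym zero_power2)+
  have "odd q" using q prime_odd_nat by blast
  then obtain k where k: "q = 2 * k + 1" by (auto elim: oddE)
  have "odd k"
    using p(2) unfolding q(3) k cong_iff_dvd_diff by presburger
  have "[-1 = x ^ k] (mod p)" "[-1 = (- x) ^ k] (mod p)"
    using euler_criterion[OF q(1,2), of x] euler_criterion[OF q(1,2), of "- x"] * nz q(3) k
    by (auto simp: Legendre_def)
  then have "[-1 + -1 = x ^ k + (- x) ^ k] (mod p)" by (rule cong_add)
  then have "p dvd 2" using \<open>odd k\<close> by (simp add: cong_iff_dvd_diff)
  then show False using \<open>p > 2\<close> by (auto dest: zdvd_imp_le)
qed

lemma prime_not_dvd_iff_coprime: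
  fixes p :: int
  assumes "prime p"
  shows "\<not> p dvd x \<longleftrightarrow> coprime x p"
  using assms by (metis coprime_absorb_right coprime_commute not_prime_unit prime_imp_coprime)

lemma QuadRes_obtain_unit:
  assumes "prime p" "QuadRes p x" "\<not> p dvd x"
  obtains w where "coprime w p" "[x = w\<^sup>2] (mod p)"
proof -
  obtain w where w: "[w\<^sup>2 = x] (mod p)" using assms(2) by (auto simp: QuadRes_def)
  then have "coprime (w\<^sup>2) p"
    using assms prime_not_dvd_iff_coprime cong_dvd_iff by blast
  with w that show ?thesis by (simp add: cong_sym)
qed

(* If sums of two unit squares were always squares, then 1, 2, ..., p - 1 would all be squares. *)
lemma ex_sum_of_two_squares_not_QuadRes:
  fixes p :: int
  assumes p: "prime p" "p > 2" "\<not> QuadRes p (-1)"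
  obtains a b where "coprime a p" "coprime b p" "\<not> QuadRes p (a\<^sup>2 + b\<^sup>2)"
proof (rule ccontr)
  assume "\<not> thesis"
  with that have *: "coprime a p \<Longrightarrow> coprime b p \<Longrightarrow> QuadRes p (a\<^sup>2 + b\<^sup>2)" for a b
    by blast
  have "0 < k \<longrightarrow> int k < p \<longrightarrow> QuadRes p (int k)" for k
  proof (induction k)
    case (Suc k)
    show ?case
    proof (cases "k = 0")
      case True
      then show ?thesis by (auto simp: QuadRes_def intro!: exI[of _ 1])
    next
      case False
      show ?thesis
      proof (intro impI)
        assume "int (Suc k) < p"
        moreover from this have "\<not> p dvd int k" using False zdvd_imp_le[of p "int k"] by auto
        ultimately obtain w where w: "coprime w p" "[int k = w\<^sup>2] (mod p)"
          using False Suc p(1) by (auto elim!: QuadRes_obtain_unit)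
        then have "QuadRes p (w\<^sup>2 + 1\<^sup>2)" by (intro *) auto
        moreover have "[w\<^sup>2 + 1\<^sup>2 = int (Suc k)] (mod p)"
          using w(2) by (auto simp: cong_iff_dvd_diff dvd_diff_commute algebra_simps)
        ultimately show "QuadRes p (int (Suc k))"
          using cong_trans[of _ "w\<^sup>2 + 1\<^sup>2" p "int (Suc k)"] unfolding QuadRes_def by blast
      qed
    qed
  qed simp
  \<comment> \<open>The induction ends at p - 1, which is -1 modulo \<open>p\<close>.\<close>
  from this[of "nat (p - 1)"] p have "QuadRes p (p - 1)" by simp
  moreover have "[p - 1 = -1] (mod p)" by (simp add: cong_iff_dvd_diff)
  ultimately have "QuadRes p (-1)" by (metis QuadRes_def cong_trans)
  with p show False by simp
qed

text \<open>Nonzero residues form two classes, the squares and the negatives of squares, so one sum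
  of two unit squares in each class suffices. Writing 1 = a^2 - b^2 gives the square a^2 = 1 + b^2;
  a nonsquare sum exists because -1 is not a square.\<close>

lemma unit_square_sum_plus_plus:
  assumes p: "prime p" "p > 5" "[p = 3] (mod 4)" and x: "\<not> p dvd x"
  shows "unit_square_sum p [1, 1] x"
proof (cases "QuadRes p x")
  case True
  then obtain w where w: "coprime w p" "[x = 1 * w\<^sup>2] (mod p)"
    using QuadRes_obtain_unit p x by auto
  obtain a b where ab: "coprime a p" "coprime b p" "p dvd 1 - 1 * a\<^sup>2 - - 1 * b\<^sup>2"
    using unit_square_sum_plus_minus[OF p(1,2), of 1] by auto
  then have "[1 + b\<^sup>2 = 1 * a\<^sup>2] (mod p)" by (simp add: cong_iff_dvd_diff algebra_simps)
  moreover have "unit_square_sum p [1, 1] (1 + b\<^sup>2)"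
    using unit_square_sum_two[of 1 p b 1 1] ab by simp
  ultimately show ?thesis using w ab unit_square_sum_class by blast
next
  case False
  have "\<not> [p = 1] (mod 4)" using p(3) by (auto simp: cong_def)
  then have "\<not> QuadRes p (-1)" using QuadRes_minus_one_iff p by simp
  then obtain a b where ab: "coprime a p" "coprime b p" "\<not> QuadRes p (a\<^sup>2 + b\<^sup>2)"
    using ex_sum_of_two_squares_not_QuadRes[of p] p by auto
  have nd: "\<not> p dvd - (a\<^sup>2 + b\<^sup>2)"
    using ab(3) unfolding QuadRes_def dvd_minus_iff
    by (metis cong_0_iff cong_sym zero_power2)
  have "QuadRes p (- (a\<^sup>2 + b\<^sup>2))" using QuadRes_or_uminus p ab by blast
  then obtain c where c: "coprime c p" "[- (a\<^sup>2 + b\<^sup>2) = c\<^sup>2] (mod p)"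
    using QuadRes_obtain_unit p(1) nd by blast
  have "QuadRes p (- x)" using False QuadRes_or_uminus p by blast
  then obtain w where w: "coprime w p" "[- x = w\<^sup>2] (mod p)"
    using QuadRes_obtain_unit[of p "- x"] p(1) x by auto
  have "unit_square_sum p [1, 1] (a\<^sup>2 + b\<^sup>2)"
    using unit_square_sum_two[of a p b 1 1] ab by simp
  moreover have "[a\<^sup>2 + b\<^sup>2 = - 1 * c\<^sup>2] (mod p)" "[x = - 1 * w\<^sup>2] (mod p)"
    using c(2) w(2) cong_minus_minus_iff by fastforce+
  ultimately show ?thesis using w c unit_square_sum_class by blast
qed

text \<open>Take 1 or 2 as the first unit: x - 1 and x - 4 differ by 3, so at least one of them is
  nonzero modulo \<open>p\<close> and is a sum of two unit squares.\<close>

lemma unit_square_sum_plus_plus_plus: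
  assumes p: "prime p" "p > 5" "[p = 3] (mod 4)"
  shows "unit_square_sum p [1, 1, 1] x"
proof (cases "p dvd x - 1\<^sup>2")
  case False
  then have "unit_square_sum p [1, 1] (x - 1 * 1\<^sup>2)"
    by (intro unit_square_sum_plus_plus[OF p]) simp
  then show ?thesis by (subst unit_square_sum.simps) (blast intro: coprime_1_left)
next
  case True
  have "\<not> p dvd x - 2\<^sup>2"
    using True prime_gt_5_not_dvd(2)[OF p(1,2)] dvd_diff[of p "x - 1\<^sup>2" "x - 2\<^sup>2"] by auto
  then have "unit_square_sum p [1, 1] (x - 1 * 2\<^sup>2)"
    by (intro unit_square_sum_plus_plus[OF p]) simp
  then show ?thesis using prime_gt_5_not_dvd(5)[OF p(1,2)]
    by (subst unit_square_sum.simps) blast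
qed

section \<open>The primes 3 and 5\<close>

lemma unit_square_sum_3_iff:
  "unit_square_sum 3 ss x \<longleftrightarrow> [x = sum_list ss] (mod 3)"
proof
  assume "unit_square_sum 3 ss x"
  then show "[x = sum_list ss] (mod 3)"
  proof (induction ss arbitrary: x)
    case (Cons s ss)
    then obtain u where u: "coprime u 3" "[x - s * u\<^sup>2 = sum_list ss] (mod 3)" by auto
    then have "\<not> 3 dvd u" using prime_not_dvd_iff_coprime[of 3] by simp
    then have "u mod 3 = 1 \<or> u mod 3 = 2" by presburger
    then have "[u\<^sup>2 = 1] (mod 3)" by (auto simp: cong_def power_mod[symmetric, of u])
    then have "[x - s * u\<^sup>2 + s * u\<^sup>2 = sum_list ss + s * 1] (mod 3)"
      using u(2) by (intro cong_add cong_mult) auto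
    then show ?case by (simp add: add.commute)
  qed (simp add: cong_0_iff)
qed (rule unit_square_sum_sum_list)

text \<open>A signed unit square is 1 or -1 modulo 5, whatever its sign was. So only the number of
  terms survives, not the pattern \<open>ss\<close>.\<close>

lemma unit_square_sum_5_imp:
  assumes "unit_square_sum 5 ss x" "set ss \<subseteq> {1, -1}"
  obtains ts where "length ts = length ss" "set ts \<subseteq> {1, -1}" "[x = sum_list ts] (mod 5)"
proof -
  have "\<exists>ts. length ts = length ss \<and> set ts \<subseteq> {1, -1} \<and> [x = sum_list ts] (mod 5)"
    using assms
  proof (induction ss arbitrary: x)
    case (Cons s ss)
    then obtain u where u: "coprime u 5" "unit_square_sum 5 ss (x - s * u\<^sup>2)" by auto
    with Cons obtain ts where
      ts: "length ts = length ss" "set ts \<subseteq> {1, -1}" "[x - s * u\<^sup>2 = sum_list ts] (mod 5)"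
      by (metis insert_subset list.simps(15))
    have "\<not> 5 dvd u" using u(1) prime_not_dvd_iff_coprime[of 5] by simp
    then have "u mod 5 = 1 \<or> u mod 5 = 2 \<or> u mod 5 = 3 \<or> u mod 5 = 4" by presburger
    then have "[u\<^sup>2 = 1] (mod 5) \<or> [u\<^sup>2 = -1] (mod 5)"
      by (auto simp: cong_def power_mod[symmetric, of u])
    moreover have "s = 1 \<or> s = -1" using Cons.prems by auto
    ultimately obtain t where t: "t \<in> {1, -1}" "[s * u\<^sup>2 = t] (mod 5)"
      using cong_minus_minus_iff[of "u\<^sup>2" 1 5] cong_minus_minus_iff[of "u\<^sup>2" "-1" 5] by fastforce
    have "[x - s * u\<^sup>2 + s * u\<^sup>2 = sum_list ts + t] (mod 5)"
      using t(2) ts(3) by (rule cong_add[rotated])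
    then show ?case using ts t by (intro exI[of _ "t # ts"]) (auto simp: add.commute)
  qed (simp add: cong_0_iff)
  with that show ?thesis by blast
qed

lemma unit_square_sum_5I:
  assumes "set ss \<subseteq> {1, -1}" "length ts = length ss" "set ts \<subseteq> {1, -1}" "[x = sum_list ts] (mod 5)"
  shows "unit_square_sum 5 ss x"
\<comment> \<open>2 is a square root of -1 modulo 5.\<close>
proof (rule unit_square_sum_change_signs[of 2])
  show "coprime (2::int) 5" by simp
  show "[2\<^sup>2 = - 1 :: int] (mod 5)" by (simp add: cong_def)
  show "unit_square_sum 5 ts x" by (rule unit_square_sum_sum_list) fact
qed (use assms in auto)

section \<open>Patterns of two and three signs modulo p > 5\<close>

lemma unit_square_sum_swap:
  assumes "unit_square_sum m (s # t # ss) x"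
  shows "unit_square_sum m (t # s # ss) x"
proof -
  obtain u v where "coprime u m" "coprime v m" "unit_square_sum m ss (x - s * u\<^sup>2 - t * v\<^sup>2)"
    using assms by auto
  moreover have "x - s * u\<^sup>2 - t * v\<^sup>2 = x - t * v\<^sup>2 - s * u\<^sup>2" by simp
  ultimately show ?thesis unfolding unit_square_sum.simps by metis
qed

lemma unit_square_sum_opposite_signs:
  assumes p: "prime p" "p > 5" and "{s, t} = {1, -1}"
  shows "unit_square_sum p [s, t] x"
proof -
  have "unit_square_sum p [1, -1] x" using unit_square_sum_plus_minus[OF p] .
  moreover from this have "unit_square_sum p [-1, 1] x" by (rule unit_square_sum_swap)
  moreover have "s = 1 \<and> t = -1 \<or> s = -1 \<and> t = 1" using assms(3) by (auto simp: doubleton_eq_iff)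
  ultimately show ?thesis by (elim disjE) (simp_all del: unit_square_sum.simps)
qed

text \<open>Here -1 is a square, so the universal pattern \<open>[1, -1]\<close> can be turned into
  any other of length two.\<close>

lemma unit_square_sum_two_terms:
  assumes p: "prime p" "p > 5" "[p = 1] (mod 4)" and "s \<in> {1, -1}" "t \<in> {1, -1}"
  shows "unit_square_sum p [s, t] x"
proof -
  obtain i where i: "[i\<^sup>2 = -1] (mod p)"
    using QuadRes_minus_one_iff[of p] p by (auto simp: QuadRes_def)
  have "coprime (i\<^sup>2) p" by (rule cong_imp_coprime[OF cong_sym[OF i]]) simp
  then have "coprime i p" by simp
  then show ?thesis
    by (rule unit_square_sum_change_signs[OF _ i _ _ _ unit_square_sum_plus_minus[OF p(1,2)]])
      (use assms(4,5) in simp_all)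
qed

text \<open>Two opposite signs already represent everything, and the third term is harmless. Three
  equal signs are treated by the residue of \<open>p\<close> modulo 4.\<close>

lemma unit_square_sum_three_terms:
  assumes p: "prime p" "p > 5" and signs: "a \<in> {1, -1}" "b \<in> {1, -1}" "c \<in> {1, -1}"
  shows "unit_square_sum p [a, b, c] x"
proof -
  have sym: "unit_square_sum p (a # [b, c]) x" if "{b, c} = {1, -1}" for a b c
    using unit_square_sum_append[of p "[b, c]" "[a]"] unit_square_sum_opposite_signs[OF p that] by simp
  show ?thesis
  proof (cases "a = b \<and> b = c")
    case False
    then have "{b, c} = {1, -1} \<or> {a, c} = {1, -1}" using signs by auto
    \<comment> \<open>If \<open>a\<close> and \<open>c\<close> are the opposite pair, swapping the
      first two terms brings them together.\<close>
    then show ?thesis using sym[of b c a] unit_square_sum_swap[OF sym[of a c b]] by blast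
  next
    case True
    have "odd p" using p prime_odd_int[of p] by simp
    then have "[p = 1] (mod 4) \<or> [p = 3] (mod 4)" unfolding cong_def by presburger
    then show ?thesis
    proof
      assume "[p = 1] (mod 4)"
      then show ?thesis
        using unit_square_sum_append[of p "[b, c]" "[a]"] unit_square_sum_two_terms p signs by simp
    next
      assume "[p = 3] (mod 4)"
      then have "unit_square_sum p [1, 1, 1] y" for y
        using unit_square_sum_plus_plus_plus p by blast
      moreover from this have "unit_square_sum p [-1, -1, -1] x"
        using unit_square_sum_uminus[of p "[1, 1, 1]" "- x"] by (simp del: unit_square_sum.simps)
      moreover have "[a, b, c] = [1, 1, 1] \<or> [a, b, c] = [-1, -1, -1]" using True signs by auto
      ultimately show ?thesis by metis
    qed
  qed
qed

section \<open>Walks in the quadratic unitary Cayley graph\<close>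

text \<open>The signs are existentially quantified because every arc of a walk may use either
  sign.\<close>

definition signed_square_sum :: "nat \<Rightarrow> nat \<Rightarrow> int \<Rightarrow> bool" where
  "signed_square_sum n k x \<longleftrightarrow>
     (\<exists>ss. length ss = k \<and> set ss \<subseteq> {1, -1} \<and> unit_square_sum (int n) ss x)"

lemma signed_square_sumI:
  "unit_square_sum (int n) ss x \<Longrightarrow> set ss \<subseteq> {1, -1} \<Longrightarrow> length ss = k \<Longrightarrow> signed_square_sum n k x"
  by (auto simp: signed_square_sum_def)

lemma signed_square_sum_cong:
  "signed_square_sum n k x \<Longrightarrow> [x = y] (mod int n) \<Longrightarrow> signed_square_sum n k y"
  by (auto simp: signed_square_sum_def intro: unit_square_sum_cong)

lemma signed_square_sum_dvd_modulus:
  "signed_square_sum n k x \<Longrightarrow> m dvd n \<Longrightarrow> signed_square_sum m k x"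
  unfolding signed_square_sum_def
  using unit_square_sum_dvd_modulus[of "int m" "int n"] by auto

lemma signed_square_sum_0_iff: "signed_square_sum n 0 x \<longleftrightarrow> int n dvd x"
  by (auto simp: signed_square_sum_def)

text \<open>Splitting off one term corresponds to prepending an arc to a walk.\<close>

lemma signed_square_sum_Suc_iff:
  "signed_square_sum n (Suc k) x \<longleftrightarrow>
     (\<exists>s\<in>{1, -1}. \<exists>u. coprime u (int n) \<and> signed_square_sum n k (x - s * u\<^sup>2))"
proof
  assume "signed_square_sum n (Suc k) x"
  then obtain ss' where "length ss' = Suc k" "set ss' \<subseteq> {1, -1}" "unit_square_sum (int n) ss' x"
    by (auto simp: signed_square_sum_def)
  then obtain s ss where "length ss = k" "set (s # ss) \<subseteq> {1, -1}" "unit_square_sum (int n) (s # ss) x"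
    by (cases ss') auto
  then show "\<exists>s\<in>{1, -1}. \<exists>u. coprime u (int n) \<and> signed_square_sum n k (x - s * u\<^sup>2)"
    unfolding signed_square_sum_def by (simp only: unit_square_sum.simps list.set) blast
next
  assume "\<exists>s\<in>{1, -1}. \<exists>u. coprime u (int n) \<and> signed_square_sum n k (x - s * u\<^sup>2)"
  then obtain s u ss where "s \<in> {1, -1}" "coprime u (int n)" "length ss = k" "set ss \<subseteq> {1, -1}"
    "unit_square_sum (int n) ss (x - s * u\<^sup>2)"
    unfolding signed_square_sum_def by blast
  then show "signed_square_sum n (Suc k) x"
    by (intro signed_square_sumI[of n "s # ss"]) auto
qed

text \<open>Translates the connection set from residue ring operations to integer congruences; the
  bounds single out the canonical representative.\<close>

lemma pm_unit_squares_iff: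
  assumes "n > 1"
  shows "t \<in> pm_unit_squares n \<longleftrightarrow> 0 \<le> t \<and> t < int n \<and> signed_square_sum n 1 t"
proof -
  interpret residues "int n" "Zmod n"
    using assms by unfold_locales auto
  have sq: "unit_squares n = {u\<^sup>2 mod int n |u. coprime u (int n)}" (is "_ = ?S")
  proof
    show "unit_squares n \<subseteq> ?S"
    proof
      fix q assume "q \<in> unit_squares n"
      then obtain u where u: "q = u [^]\<^bsub>Zmod n\<^esub> (2::nat)" "0 < u" "u < int n" "coprime u (int n)"
        by (auto simp: unit_squares_def res_units_eq)
      then have "q = u\<^sup>2 mod int n" using pow_cong[of u 2] by simp
      with u show "q \<in> ?S" by blast
    qed
    show "?S \<subseteq> unit_squares n"
    proof
      fix q assume "q \<in> ?S"
      then obtain u where u: "q = u\<^sup>2 mod int n" "coprime u (int n)" by blast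
      then have "q = (u mod int n) [^]\<^bsub>Zmod n\<^esub> (2::nat)" using pow_cong[of u 2] by simp
      moreover have "u mod int n \<in> Units (Zmod n)" using u assms by simp
      ultimately show "q \<in> unit_squares n" unfolding unit_squares_def by blast
    qed
  qed
  have neg: "\<ominus>\<^bsub>Zmod n\<^esub> (x mod int n) = (- x) mod int n" for x
    by (rule neg_cong)
  have "t \<in> pm_unit_squares n \<longleftrightarrow>
      (\<exists>u. coprime u (int n) \<and> (t = u\<^sup>2 mod int n \<or> t = (- u\<^sup>2) mod int n))"
    unfolding pm_unit_squares_def sq using neg by auto metis
  also have "\<dots> \<longleftrightarrow> 0 \<le> t \<and> t < int n \<and>
      (\<exists>u. coprime u (int n) \<and> ([t = u\<^sup>2] (mod int n) \<or> [t = - u\<^sup>2] (mod int n)))"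
    using assms by (auto simp: cong_def)
  also have "\<dots> \<longleftrightarrow> 0 \<le> t \<and> t < int n \<and> signed_square_sum n 1 t"
    by (auto simp: One_nat_def signed_square_sum_Suc_iff signed_square_sum_0_iff cong_iff_dvd_diff)
  finally show ?thesis .
qed

lemma parcs_quad_unitary_cayley_graph_iff:
  assumes "n > 1"
  shows "(a, b) \<in> parcs (quad_unitary_cayley_graph n) \<longleftrightarrow>
    a \<in> {0..<int n} \<and> b \<in> {0..<int n} \<and> signed_square_sum n 1 (a - b)"
proof -
  interpret residues "int n" "Zmod n"
    using assms by unfold_locales auto
  have "a \<ominus>\<^bsub>Zmod n\<^esub> b = (a - b) mod int n"
    by (simp add: a_minus_def res_add_eq res_neg_eq mod_simps)
  then show ?thesis
    using assms unfolding quad_unitary_cayley_graph_def cayley_graph_def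
    by (auto simp: res_carrier_eq pm_unit_squares_iff intro: signed_square_sum_cong)
qed

text \<open>Induction on the length: a first arc from \<open>a\<close> to \<open>c\<close> means
  that a - c is one signed unit square, which leaves c - b for the rest of the walk.\<close>

lemma awalk_quad_unitary_cayley_graph_iff:
  assumes "n > 1"
  shows "(\<exists>p. pre_digraph.awalk (with_proj (quad_unitary_cayley_graph n)) a p b \<and> length p = k) \<longleftrightarrow>
    a \<in> {0..<int n} \<and> b \<in> {0..<int n} \<and> signed_square_sum n k (a - b)"
proof -
  let ?G = "quad_unitary_cayley_graph n"
  interpret pair_graph ?G by (rule pair_graph_quad_unitary_cayley_graph) fact
  have verts: "pverts ?G = {0..<int n}"
    by (auto simp: quad_unitary_cayley_graph_def cayley_graph_def residue_ring_def)
  note arcs = parcs_quad_unitary_cayley_graph_iff[OF assms]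
  show ?thesis
  proof (induction k arbitrary: a)
    case 0
    show ?case
      using assms by (auto simp: awalk_Nil_iff verts signed_square_sum_0_iff
          dest: zdvd_not_zless intro!: exI[of _ "[]"])
        (metis atLeastLessThan_iff cong_iff_dvd_diff cong_less_imp_eq_int)
  next
    case (Suc k)
    have "(\<exists>p. awalk a p b \<and> length p = Suc k) \<longleftrightarrow>
        (\<exists>c. (a, c) \<in> parcs ?G \<and> (\<exists>p. awalk c p b \<and> length p = k))" (is "?L \<longleftrightarrow> ?R")
    proof
      assume ?L
      then obtain e p where "awalk a (e # p) b" "length p = k" by (auto simp: length_Suc_conv)
      then show ?R by (cases e) (auto simp: awalk_Cons_iff)
    next
      assume ?R
      then obtain c p where "(a, c) \<in> parcs ?G" "awalk c p b" "length p = k" by blast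
      then show ?L by (intro exI[of _ "(a, c) # p"]) (auto simp: awalk_Cons_iff)
    qed
    also have "\<dots> \<longleftrightarrow> a \<in> {0..<int n} \<and> b \<in> {0..<int n} \<and> signed_square_sum n (Suc k) (a - b)"
      (is "_ \<longleftrightarrow> ?R")
    proof
      assume "\<exists>c. (a, c) \<in> parcs ?G \<and> (\<exists>p. awalk c p b \<and> length p = k)"
      then obtain c s u where c: "a \<in> {0..<int n}" "b \<in> {0..<int n}" "signed_square_sum n k (c - b)"
        and su: "s \<in> {1, -1}" "coprime u (int n)" "int n dvd a - c - s * u\<^sup>2"
        unfolding Suc.IH arcs One_nat_def signed_square_sum_Suc_iff signed_square_sum_0_iff by blast
      have "[c - b = a - b - s * u\<^sup>2] (mod int n)"
        using su(3) by (simp add: cong_iff_dvd_diff dvd_diff_commute algebra_simps)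
      with c su show ?R unfolding signed_square_sum_Suc_iff
        using signed_square_sum_cong by blast
    next
      assume ?R
      then obtain s u where su: "s \<in> {1, -1}" "coprime u (int n)"
        "signed_square_sum n k (a - b - s * u\<^sup>2)"
        unfolding signed_square_sum_Suc_iff by blast
      \<comment> \<open>The next vertex is obtained by removing the first term from \<open>a\<close>
        and reducing to the vertex range.\<close>
      define c where "c = (a - s * u\<^sup>2) mod int n"
      have "[a - b - s * u\<^sup>2 = c - b] (mod int n)"
        by (simp add: c_def cong_def mod_simps algebra_simps)
      then have "signed_square_sum n k (c - b)" using su signed_square_sum_cong by blast
      moreover have "[a - s * u\<^sup>2 = c] (mod int n)" by (simp add: c_def cong_def)
      then have "int n dvd a - c - s * u\<^sup>2" by (simp add: cong_iff_dvd_diff algebra_simps)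
      then have "signed_square_sum n 1 (a - c)"
        unfolding One_nat_def signed_square_sum_Suc_iff signed_square_sum_0_iff using su by blast
      moreover have "c \<in> {0..<int n}" using assms by (simp add: c_def)
      ultimately show "\<exists>c. (a, c) \<in> parcs ?G \<and> (\<exists>p. awalk c p b \<and> length p = k)"
        unfolding Suc.IH arcs using \<open>?R\<close> by blast
    qed
    finally show ?case .
  qed
qed

text \<open>Walk lengths between two vertices depend only on their difference, so a single residue
  \<open>x\<close> witnesses the lower bound, through the pair \<open>x mod int n\<close> and
  0.\<close>

lemma diam_G_eqI:
  assumes "n > 1"
    and upper: "\<And>x. \<exists>k\<le>d. signed_square_sum n k x"
    and lower: "\<And>k. k < d \<Longrightarrow> \<not> signed_square_sum n k x"
  shows "diam_G n = ereal (real d)"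
proof -
  let ?G = "quad_unitary_cayley_graph n"
  interpret pair_graph ?G by (rule pair_graph_quad_unitary_cayley_graph) fact
  have verts: "pverts ?G = {0..<int n}"
    by (auto simp: quad_unitary_cayley_graph_def cayley_graph_def residue_ring_def)
  note walks = awalk_quad_unitary_cayley_graph_iff[OF assms(1)]
  have cost: "awalk_cost (\<lambda>_. 1) p = real (length p)" for p :: "(int \<times> int) list"
    by (simp add: awalk_cost_def sum_list_triv)
  have "diameter \<le> ereal (real d)"
    unfolding diameter_def
  proof (intro SUP_least)
    fix a b assume "a \<in> pverts ?G" "b \<in> pverts ?G"
    moreover obtain k where k: "k \<le> d" "signed_square_sum n k (a - b)" using upper by blast
    ultimately obtain p where p: "awalk a p b" "length p = k"
      using walks[of a b k] verts by metis
    then have "\<mu> (\<lambda>_. 1) a b \<le> ereal (real k)"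
      using min_cost_le_walk_cost[OF p(1), of "\<lambda>_. 1"] cost by simp
    also have "\<dots> \<le> ereal (real d)" using k by simp
    finally show "\<mu> (\<lambda>_. 1) a b \<le> ereal (real d)" .
  qed
  moreover have "ereal (real d) \<le> diameter"
  proof -
    have "ereal (real d) \<le> \<mu> (\<lambda>_. 1) (x mod int n) 0"
      unfolding \<mu>_def
    proof (intro INF_greatest)
      fix p assume "p \<in> {p. awalk (x mod int n) p 0}"
      then have "signed_square_sum n (length p) (x mod int n - 0)" using walks by blast
      then have "signed_square_sum n (length p) x" using signed_square_sum_cong by fastforce
      then have "d \<le> length p" using lower by (meson not_le)
      then show "ereal (real d) \<le> ereal (awalk_cost (\<lambda>_. 1) p)" by (simp add: cost)
    qed
    also have "\<dots> \<le> diameter"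
      unfolding diameter_def using assms(1) verts
      by (intro SUP_upper2[of "x mod int n"] SUP_upper2[of 0]) auto
    finally show ?thesis .
  qed
  ultimately show ?thesis unfolding diam_G_def by (rule antisym)
qed

section \<open>The diameter\<close>

text \<open>Reduces a representation modulo \<open>n\<close> to conditions at its primes. At 5 the
  list \<open>ts\<close> may differ from \<open>ss\<close>, since signs can be changed freely there;
  at 3 the signs themselves must fit.\<close>

lemma signed_square_sum_lift:
  assumes "odd n" "ss \<noteq> []" "set ss \<subseteq> {1, -1}"
    and "3 dvd n \<Longrightarrow> [x = sum_list ss] (mod 3)"
    and "5 dvd n \<Longrightarrow> \<exists>ts. length ts = length ss \<and> set ts \<subseteq> {1, -1} \<and> [x = sum_list ts] (mod 5)"
    and "\<And>p. prime p \<Longrightarrow> p dvd int n \<Longrightarrow> p > 5 \<Longrightarrow> unit_square_sum p ss x"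
  shows "signed_square_sum n (length ss) x"
proof (rule signed_square_sumI[OF unit_square_sum_local_global])
  fix p :: int assume p: "prime p" "p dvd int n"
  have "odd p" using assms(1) p(2) dvd_trans even_of_nat_iff by blast
  then have "p \<noteq> 2" "p \<noteq> 4" by auto
  then have "p = 3 \<or> p = 5 \<or> p > 5" using prime_ge_2_int[OF p(1)] by linarith
  then consider "p = 3" | "p = 5" | "p > 5" by blast
  then show "unit_square_sum p ss x"
  proof cases
    case 1
    with p have "3 dvd n" by presburger
    with 1 assms(4) show ?thesis using unit_square_sum_sum_list by blast
  next
    case 2
    with p have "5 dvd n" by presburger
    with 2 assms(3,5) show ?thesis using unit_square_sum_5I by blast
  next
    case 3
    with p assms(6) show ?thesis by blast
  qed
qed (use assms in auto)

lemma cong_1_mod_4_if_delta3_eq_0: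
  assumes "odd n" "delta3 n = 0" "prime p" "p dvd int n" "p > 5"
  shows "[p = 1] (mod 4)"
proof -
  define q where "q = nat p"
  have q: "prime q" "q dvd n" "q > 3" "p = int q"
    using assms by (auto simp: q_def nat_dvd_iff)
  then have "\<not> [q = 3] (mod 4)" using assms(2) by (auto simp: delta3_def split: if_splits)
  moreover have "odd q" using q(2) assms(1) by auto
  then have "q mod 4 = 1 \<or> q mod 4 = 3" by presburger
  ultimately have "[q = 1] (mod 4)" by (auto simp: cong_def)
  then show ?thesis unfolding q(4) using cong_int_iff[of q 1 4] by simp
qed

text \<open>If 3 divides n, the residue of x modulo 3 dictates the signs; then every prime p > 5
  dividing n is 1 mod 4 and accepts any two signs. Otherwise opposite signs work at all p > 5.
  Modulo 5 two signs sum to 0, 2 or -2.\<close>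

lemma signed_square_sum_2:
  assumes "odd n" "3 dvd n \<Longrightarrow> delta3 n = 0" "5 dvd n \<Longrightarrow> \<not> [x = 1] (mod 5) \<and> \<not> [x = -1] (mod 5)"
  shows "signed_square_sum n 2 x"
proof -
  have "\<exists>s t. s \<in> {1, -1} \<and> t \<in> {1, -1} \<and> (if 3 dvd n then [x = s + t] (mod 3) else s = 1 \<and> t = -1)"
  proof -
    have "x mod 3 = 0 \<or> x mod 3 = 1 \<or> x mod 3 = 2" by presburger
    then have "[x = 1 + -1] (mod 3) \<or> [x = -1 + -1] (mod 3) \<or> [x = 1 + 1] (mod 3)"
      by (auto simp: cong_def)
    then show ?thesis by (metis insertCI)
  qed
  then obtain s t where st: "s \<in> {1, -1}" "t \<in> {1, -1}"
    "if 3 dvd n then [x = s + t] (mod 3) else s = 1 \<and> t = -1" by blast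
  have "signed_square_sum n (length [s, t]) x"
  proof (rule signed_square_sum_lift)
    show "[x = sum_list [s, t]] (mod 3)" if "3 dvd n" using st that by simp
    show "\<exists>ts. length ts = length [s, t] \<and> set ts \<subseteq> {1, -1} \<and> [x = sum_list ts] (mod 5)" if "5 dvd n"
    proof -
      have "x mod 5 = 0 \<or> x mod 5 = 2 \<or> x mod 5 = 3"
      proof -
        have "x mod 5 = 0 \<or> x mod 5 = 1 \<or> x mod 5 = 2 \<or> x mod 5 = 3 \<or> x mod 5 = 4"
          by presburger
        then show ?thesis using assms(3)[OF that] by (auto simp: cong_def)
      qed
      then have "[x = sum_list [1, -1]] (mod 5) \<or> [x = sum_list [1, 1]] (mod 5)
          \<or> [x = sum_list [-1, -1]] (mod 5)"
        by (auto simp: cong_def)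
      moreover have "length ts = length [s, t] \<and> set ts \<subseteq> {1, -1}"
        if "ts \<in> {[1, -1], [1, 1], [-1, -1]}" for ts :: "int list"
        using that by auto
      ultimately show ?thesis by blast
    qed
    show "unit_square_sum p [s, t] x" if "prime p" "p dvd int n" "p > 5" for p
    proof (cases "3 dvd n")
      case True
      then show ?thesis
        using assms st that cong_1_mod_4_if_delta3_eq_0 unit_square_sum_two_terms by blast
    next
      case False
      then show ?thesis using st that unit_square_sum_plus_minus by simp
    qed
  qed (use assms st in auto)
  then show ?thesis by (simp add: numeral_2_eq_2)
qed

text \<open>Three signs sum to 1, -1, 3 or -3, which covers all residues modulo 3 and the nonzero
  ones modulo 5. Larger primes accept every triple, so the signs are chosen to fit modulo 3.\<close>

lemma signed_square_sum_3:
  assumes "odd n" "5 dvd n \<Longrightarrow> \<not> [x = 0] (mod 5)"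
  shows "signed_square_sum n 3 x"
proof -
  have "\<exists>a\<in>{1, -1}. \<exists>b\<in>{1, -1}. \<exists>c\<in>{1, -1}. [x = sum_list [a, b, c]] (mod 3)"
    unfolding cong_def by simp presburger
  then obtain a b c where abc: "a \<in> {1, -1}" "b \<in> {1, -1}" "c \<in> {1, -1}"
    "[x = sum_list [a, b, c]] (mod 3)" by blast
  have "signed_square_sum n (length [a, b, c]) x"
  proof (rule signed_square_sum_lift)
    show "\<exists>ts. length ts = length [a, b, c] \<and> set ts \<subseteq> {1, -1} \<and> [x = sum_list ts] (mod 5)" if "5 dvd n"
    proof -
      have "\<exists>a'\<in>{1, -1}. \<exists>b'\<in>{1, -1}. \<exists>c'\<in>{1, -1}. [x = sum_list [a', b', c']] (mod 5)"
        using assms(2)[OF that] unfolding cong_def by simp presburger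
      then obtain a' b' c' where "a' \<in> {1, -1}" "b' \<in> {1, -1}" "c' \<in> {1, -1}"
        "[x = sum_list [a', b', c']] (mod 5)" by blast
      then show ?thesis by (intro exI[of _ "[a', b', c']"]) simp
    qed
    show "unit_square_sum p [a, b, c] x" if "prime p" "p > 5" for p
      using unit_square_sum_three_terms that abc by blast
  qed (use assms abc in auto)
  then show ?thesis by (simp add: numeral_3_eq_3)
qed

text \<open>Four signs sum to 0, 2, -2, 4 or -4, which covers all residues modulo 3 and modulo
  5.\<close>

lemma signed_square_sum_4:
  assumes "odd n"
  shows "signed_square_sum n 4 x"
proof -
  have "\<exists>a\<in>{1, -1}. \<exists>b\<in>{1, -1}. \<exists>c\<in>{1, -1}. \<exists>d\<in>{1, -1}. [x = sum_list [a, b, c, d]] (mod 3)"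
    unfolding cong_def by simp presburger
  then obtain a b c d where abc: "a \<in> {1, -1}" "b \<in> {1, -1}" "c \<in> {1, -1}" "d \<in> {1, -1}"
    "[x = sum_list [a, b, c, d]] (mod 3)" by blast
  have "signed_square_sum n (length [a, b, c, d]) x"
  proof (rule signed_square_sum_lift)
    show "\<exists>ts. length ts = length [a, b, c, d] \<and> set ts \<subseteq> {1, -1} \<and> [x = sum_list ts] (mod 5)"
    proof -
      have "\<exists>a'\<in>{1, -1}. \<exists>b'\<in>{1, -1}. \<exists>c'\<in>{1, -1}. \<exists>d'\<in>{1, -1}.
          [x = sum_list [a', b', c', d']] (mod 5)"
        unfolding cong_def by simp presburger
      then obtain a' b' c' d' where "a' \<in> {1, -1}" "b' \<in> {1, -1}" "c' \<in> {1, -1}" "d' \<in> {1, -1}"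
        "[x = sum_list [a', b', c', d']] (mod 5)" by blast
      then show ?thesis by (intro exI[of _ "[a', b', c', d']"]) simp
    qed
    show "unit_square_sum p [a, b, c, d] x" if "prime p" "p > 5" for p
      using unit_square_sum_append[of p "[b, c, d]" "[a]"] unit_square_sum_three_terms that abc
      by simp
  qed (use assms abc in auto)
  then show ?thesis by (simp add: eval_nat_numeral)
qed

section \<open>Lower bounds: residues missed by short sums\<close>

lemma not_signed_square_sum_1:
  assumes "prime q" "q dvd n" "int q dvd x"
  shows "\<not> signed_square_sum n 1 x"
proof
  assume "signed_square_sum n 1 x"
  then have "signed_square_sum q 1 x" using assms signed_square_sum_dvd_modulus by blast
  then obtain s u where u: "s \<in> {1, -1}" "coprime u (int q)" "int q dvd x - s * u\<^sup>2"
    unfolding One_nat_def signed_square_sum_Suc_iff signed_square_sum_0_iff by blast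
  then have "int q dvd s * u\<^sup>2" using assms(3) by (metis dvd_diff_right_iff dvd_diffD1 dvd_diffD)
  then have "int q dvd u\<^sup>2" using u(1) by auto
  then have "int q dvd u" using assms(1) prime_dvd_power by (metis prime_int_nat_transfer nat_int of_nat_0_le_iff)
  then show False using u(2) assms(1) prime_not_dvd_iff_coprime[of "int q" u] by simp
qed

text \<open>The residue 1 modulo 3 forces both signs to be -1. Then u^2 + v^2 = 0 modulo
  \<open>q\<close> for units u and v, so (v / u)^2 = -1, contradicting q = 3 mod 4.\<close>

lemma not_signed_square_sum_2_mod_3:
  assumes "3 dvd n" and q: "prime q" "q dvd n" "q > 3" "[q = 3] (mod 4)"
    and x: "[x = 1] (mod 3)" "int q dvd x"
  shows "\<not> signed_square_sum n 2 x"
proof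
  assume "signed_square_sum n 2 x"
  then obtain ss where ss: "length ss = 2" "set ss \<subseteq> {1, -1}" "unit_square_sum (int n) ss x"
    by (auto simp: signed_square_sum_def)
  obtain s t where st: "ss = [s, t]" using ss(1) by (auto simp: length_Suc_conv numeral_2_eq_2)
  have "(3::int) dvd int n" using assms(1) by presburger
  then have "unit_square_sum 3 ss x" using ss(3) unit_square_sum_dvd_modulus by blast
  then have "[1 = s + t] (mod 3)" using x(1) st unit_square_sum_3_iff
    by (metis cong_sym cong_trans sum_list.Cons sum_list.Nil add_0_right)
  then have "s = -1" "t = -1" using ss(2) st by (auto simp: cong_def)
  moreover have "unit_square_sum (int q) ss x"
    using ss(3) q(2) unit_square_sum_dvd_modulus[of "int q" "int n"] by simp
  ultimately obtain u v where uv: "coprime u (int q)" "coprime v (int q)" "int q dvd x + u\<^sup>2 + v\<^sup>2"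
    using st by auto
  then have uv0: "int q dvd u\<^sup>2 + v\<^sup>2" using x(2) by (simp add: add.assoc dvd_add_right_iff)
  obtain w where w: "[u * w = 1] (mod int q)" using uv(1) cong_solve_coprime_int by blast
  have "[(v * w)\<^sup>2 = -1] (mod int q)"
  proof -
    have "[(u\<^sup>2 + v\<^sup>2) * w\<^sup>2 - (u * w)\<^sup>2 = 0 * w\<^sup>2 - 1\<^sup>2] (mod int q)"
      using w uv0 by (intro cong_diff cong_mult cong_pow) (auto simp: cong_0_iff)
    then show ?thesis by (simp add: algebra_simps)
  qed
  then have "QuadRes (int q) (-1)" by (auto simp: QuadRes_def)
  then have "[int q = 1] (mod 4)" using QuadRes_minus_one_iff[of "int q"] q by simp
  then show False using q(4) cong_int_iff[of q 3 4] by (simp add: cong_def)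
qed

text \<open>Two signs sum to 0, 2 or -2, none of which is 1 modulo 5.\<close>

lemma not_signed_square_sum_2_mod_5:
  assumes "5 dvd n" "[x = 1] (mod 5)"
  shows "\<not> signed_square_sum n 2 x"
proof
  assume "signed_square_sum n 2 x"
  then have "signed_square_sum 5 2 x" using assms(1) signed_square_sum_dvd_modulus by blast
  then obtain ss where "length ss = 2" "set ss \<subseteq> {1, -1}" "unit_square_sum 5 ss x"
    by (auto simp: signed_square_sum_def)
  then obtain ts where ts: "length ts = 2" "set ts \<subseteq> {1, -1}" "[x = sum_list ts] (mod 5)"
    by (metis unit_square_sum_5_imp)
  have "[sum_list ts = 1] (mod 5)" using cong_trans[OF cong_sym[OF ts(3)] assms(2)] .
  with ts(1,2) show False by (auto simp: length_Suc_conv numeral_2_eq_2 cong_def)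
qed

text \<open>Three signs sum to an odd number between -3 and 3, never 0 modulo 5.\<close>

lemma not_signed_square_sum_3_mod_5:
  assumes "5 dvd n" "5 dvd x"
  shows "\<not> signed_square_sum n 3 x"
proof
  assume "signed_square_sum n 3 x"
  then have "signed_square_sum 5 3 x" using assms(1) signed_square_sum_dvd_modulus by blast
  then obtain ss where "length ss = 3" "set ss \<subseteq> {1, -1}" "unit_square_sum 5 ss x"
    by (auto simp: signed_square_sum_def)
  then obtain ts where ts: "length ts = 3" "set ts \<subseteq> {1, -1}" "[x = sum_list ts] (mod 5)"
    by (metis unit_square_sum_5_imp)
  have "[x = 0] (mod 5)" using assms(2) by (simp add: cong_0_iff)
  then have "[sum_list ts = 0] (mod 5)" using cong_trans[OF cong_sym[OF ts(3)]] by blast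
  with ts(1,2) show False by (auto simp: length_Suc_conv numeral_3_eq_3 cong_def)
qed

section \<open>Exact diameters by the factorization of n\<close>

text \<open>Were squaring surjective on the finite set of residues, it would be injective; but 1 and
  p - 1 have the same square.\<close>

lemma ex_not_QuadRes:
  fixes p :: int
  assumes "p > 2"
  shows "\<exists>x. \<not> QuadRes p x"
proof (rule ccontr)
  assume *: "\<nexists>x. \<not> QuadRes p x"
  let ?A = "{0..<p}" and ?f = "\<lambda>x. x\<^sup>2 mod p"
  have "?A \<subseteq> ?f ` ?A"
  proof
    fix x assume x: "x \<in> ?A"
    from * obtain y where "[y\<^sup>2 = x] (mod p)" by (auto simp: QuadRes_def)
    then have "x = ?f (y mod p)" using x by (simp add: cong_def power_mod)
    moreover have "y mod p \<in> ?A" using assms by simp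
    ultimately show "x \<in> ?f ` ?A" by blast
  qed
  then have "inj_on ?f ?A" by (intro finite_surj_inj) auto
  then have inj: "1 = p - 1" if "?f 1 = ?f (p - 1)"
    using that assms by (intro inj_onD[of ?f ?A 1 "p - 1"]) simp_all
  have "?f 1 = ?f (p - 1)"
  proof -
    have "(p - 1)\<^sup>2 = 1\<^sup>2 + p * (p - 2)" by (simp add: power2_eq_square algebra_simps)
    then show ?thesis by (metis mod_mult_self2)
  qed
  then show False using inj assms by simp
qed

lemma omega_eq_1_dvd_unique:
  assumes "omega n = 1" "prime p" "prime q" "p dvd n" "q dvd n" "n > 0"
  shows "p = q"
proof -
  obtain r where "prime_factors n = {r}" using assms(1) by (auto simp: omega_def card_1_singleton_iff)
  moreover have "p \<in> prime_factors n" "q \<in> prime_factors n"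
    using assms by (auto simp: prime_factors_dvd)
  ultimately show ?thesis by simp
qed

lemma omega_gt_1_other_prime:
  assumes "omega n > 1"
  obtains q where "prime q" "q dvd n" "q \<noteq> p"
proof -
  have "\<not> prime_factors n \<subseteq> {p}"
    using assms card_mono[of "{p}" "prime_factors n"] by (auto simp: omega_def)
  then show ?thesis using that by auto
qed

text \<open>Two terms can only fail for powers of 5 with x = 1 or -1 modulo 5, and there one term
  suffices. A power of 3 has no larger prime factor to obstruct equal signs.\<close>

lemma signed_square_sum_le_2_omega_1:
  assumes "n > 1" "odd n" "omega n = 1"
  shows "\<exists>k\<le>2. signed_square_sum n k x"
proof (cases "5 dvd n \<and> ([x = 1] (mod 5) \<or> [x = -1] (mod 5))")
  case True
  have 5: "p = 5" if "prime p" "p dvd n" for p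
    using omega_eq_1_dvd_unique[OF assms(3), of p 5] that True assms by simp
  have "signed_square_sum n (length [1::int]) x"
  proof (rule signed_square_sum_lift)
    show "[x = sum_list [1]] (mod 3)" if "3 dvd n" using 5[of 3] that by simp
    show "\<exists>ts. length ts = length [1::int] \<and> set ts \<subseteq> {1, - 1} \<and> [x = sum_list ts] (mod 5)"
      using True by (auto intro: exI[of _ "[1]"] exI[of _ "[-1]"])
    show "unit_square_sum p [1] x" if "prime p" "p dvd int n" "p > 5" for p
      using 5[of "nat p"] that by (simp add: nat_dvd_iff)
  qed (use assms in auto)
  then show ?thesis by (intro exI[of _ 1]) simp
next
  case False
  have "delta3 n = 0" if "3 dvd n"
    using omega_eq_1_dvd_unique[OF assms(3), of 3] that assms by (auto simp: delta3_def)
  with False assms show ?thesis using signed_square_sum_2 by blast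
qed

text \<open>Every nonzero residue is a square or the negative of one, so the graph is
  complete.\<close>

lemma diam_G_prime_3_mod_4:
  assumes "prime n" "[n = 3] (mod 4)"
  shows "diam_G n = ereal (real 1)"
proof (rule diam_G_eqI)
  show "n > 1" using assms(1) prime_gt_1_nat by blast
  show "\<not> signed_square_sum n k 1" if "k < 1" for k
    using that \<open>n > 1\<close> by (auto simp: signed_square_sum_0_iff)
  show "\<exists>k\<le>1. signed_square_sum n k x" for x
  proof (cases "int n dvd x")
    case True
    then show ?thesis by (intro exI[of _ 0]) (simp add: signed_square_sum_0_iff)
  next
    case False
    have "[int n = 3] (mod 4)" using assms(2) cong_int_iff[of n 3 4] by simp
    then have "QuadRes (int n) x \<or> QuadRes (int n) (- x)"
      using QuadRes_or_uminus assms(1) by simp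
    then have "\<exists>s\<in>{1, -1}. QuadRes (int n) (s * x)" by simp
    then obtain s where s: "s \<in> {1, -1}" "QuadRes (int n) (s * x)" by blast
    have nd: "\<not> int n dvd s * x" using False s(1) by auto
    have "prime (int n)" using assms(1) by simp
    then obtain w where w: "coprime w (int n)" "[s * x = w\<^sup>2] (mod int n)"
      by (rule QuadRes_obtain_unit[OF _ s(2) nd])
    have "[s * (s * x) = s * w\<^sup>2] (mod int n)" using w(2) by (intro cong_mult) auto
    moreover have "s * (s * x) = x" using s(1) by auto
    ultimately have "signed_square_sum n 1 x"
      unfolding One_nat_def signed_square_sum_Suc_iff signed_square_sum_0_iff
      using s(1) w(1) by (auto simp: cong_iff_dvd_diff)
    then show ?thesis by blast
  qed
qed

text \<open>As -1 is a square, negated squares are squares again, so a nonresidue is neither 0 nor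
  one step away from 0.\<close>

lemma diam_G_prime_1_mod_4:
  assumes "prime n" "[n = 1] (mod 4)"
  shows "diam_G n = ereal (real 2)"
proof -
  have n4: "[int n = 1] (mod 4)" using assms(2) cong_int_iff[of n 1 4] by simp
  have n: "n > 1" "odd n" using assms prime_gt_1_nat unfolding cong_def by (blast, presburger)
  then have "int n > 2" using even_numeral by (cases "n = 2") auto
  then obtain x where x: "\<not> QuadRes (int n) x" using ex_not_QuadRes by blast
  have "QuadRes (int n) (-1)"
    using QuadRes_minus_one_iff[of "int n"] n4 assms(1) \<open>int n > 2\<close> by simp
  then obtain i where i: "[i\<^sup>2 = -1] (mod int n)" by (auto simp: QuadRes_def)
  have "\<not> signed_square_sum n 0 x"
    using x unfolding signed_square_sum_0_iff QuadRes_def by (metis cong_0_iff cong_sym zero_power2)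
  moreover have "\<not> signed_square_sum n 1 x"
  proof
    assume "signed_square_sum n 1 x"
    then obtain s u where u: "s \<in> {1, -1}" "[x = s * u\<^sup>2] (mod int n)"
      unfolding One_nat_def signed_square_sum_Suc_iff signed_square_sum_0_iff cong_iff_dvd_diff by blast
    have "[(i * u)\<^sup>2 = -1 * u\<^sup>2] (mod int n)"
      unfolding power_mult_distrib using i by (intro cong_mult) auto
    then show False using u x by (auto simp: QuadRes_def) (metis cong_sym cong_trans)+
  qed
  moreover have "omega n = 1" using assms(1) by (simp add: omega_def prime_prime_factors)
  ultimately show ?thesis
    using n signed_square_sum_le_2_omega_1
    by (intro diam_G_eqI[where x = x]) (auto simp: less_2_cases_iff)
qed

lemma not_signed_square_sum_le_1:
  assumes "prime q" "q dvd n" "int q dvd x" "\<not> int n dvd x" "k < 2"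
  shows "\<not> signed_square_sum n k x"
proof -
  have "k = 0 \<or> k = 1" using assms(5) by linarith
  with assms show ?thesis using not_signed_square_sum_1 signed_square_sum_0_iff by metis
qed

text \<open>The prime factor \<open>q\<close> of the composite \<open>n\<close> is a nonzero
  nonunit, hence at distance at least 2 from 0.\<close>

lemma diam_G_prime_power:
  assumes "n > 1" "odd n" "omega n = 1" "\<not> prime n"
  shows "diam_G n = ereal (real 2)"
proof -
  obtain q where q: "prime q" "q dvd n" using assms(1) prime_factor_nat by (metis less_irrefl)
  then have "\<not> int n dvd int q" using assms(4) by (auto dest: dvd_antisym)
  with q assms show ?thesis
    using signed_square_sum_le_2_omega_1 not_signed_square_sum_le_1[of q n "int q"]
    by (intro diam_G_eqI[where x = "int q"]) auto
qed

text \<open>Each case exhibits a nonzero residue divisible by some prime \<open>q\<close> dividing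
  n, which rules out at most one term; further congruences modulo 3 and 5 rule out two or three
  terms.\<close>

lemma diam_G_omega_gt_1:
  assumes "n > 1" "odd n" "omega n > 1"
  shows "diam_G n = ereal (real (2 + gamma3 n * delta3 n + gamma5 n))"
proof -
  have delta3: "delta3 n = 0 \<or> delta3 n = 1" by (simp add: delta3_def)
  have crt: "\<exists>x. [x = a] (mod int p) \<and> [x = b] (mod int q)"
    if "prime p" "prime q" "p \<noteq> q" for p q :: nat and a b
    using that by (intro binary_chinese_remainder_int) (simp add: primes_coprime)
  have "diam_G n = ereal (real 2)" if c: "\<not> (3 dvd n \<and> delta3 n = 1)" "\<not> 5 dvd n"
  proof -
    obtain q where q: "prime q" "q dvd n" using omega_gt_1_other_prime assms(3) by metis
    have "n \<noteq> q" using assms(3) q by (auto simp: omega_def prime_prime_factors)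
    then have "\<not> int n dvd int q" using q by (auto dest: dvd_antisym)
    moreover have "3 dvd n \<Longrightarrow> delta3 n = 0" using c delta3 by blast
    ultimately show ?thesis
      using signed_square_sum_2[OF assms(2)] c(2) q assms not_signed_square_sum_le_1[of q n "int q"]
      by (intro diam_G_eqI[where x = "int q"]) auto
  qed
  moreover have "diam_G n = ereal (real 3)" if c: "3 dvd n" "delta3 n = 1" "\<not> 5 dvd n"
  proof -
    obtain q where q: "prime q" "q dvd n" "q > 3" "[q = 3] (mod 4)"
      using c(2) by (auto simp: delta3_def split: if_splits)
    obtain x where x: "[x = 1] (mod 3)" "[x = 0] (mod int q)"
      using crt[of 3 q 1 0] q by auto
    then have qx: "int q dvd x" by (simp add: cong_0_iff)
    have "\<not> 3 dvd x" using x(1) unfolding cong_def by presburger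
    then have "\<not> int n dvd x" using c(1) by (metis dvd_trans int_dvd_int_iff of_nat_numeral)
    then have "\<not> signed_square_sum n k x" if "k < 2" for k
      using not_signed_square_sum_le_1 q qx that by blast
    moreover have "\<not> signed_square_sum n 2 x"
      using not_signed_square_sum_2_mod_3 c q x qx by blast
    ultimately have "\<not> signed_square_sum n k x" if "k < 3" for k
      using that by (metis less_Suc_eq numeral_3_eq_3 numeral_2_eq_2)
    then show ?thesis
      using signed_square_sum_3[OF assms(2)] c assms(1)
      by (intro diam_G_eqI[where x = x]) auto
  qed
  moreover have "diam_G n = ereal (real 3)" if c: "\<not> (3 dvd n \<and> delta3 n = 1)" "5 dvd n"
  proof -
    obtain q where q: "prime q" "q dvd n" "q \<noteq> 5" using omega_gt_1_other_prime assms(3) by metis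
    \<comment> \<open>Divisibility by \<open>q\<close> rules out one term and the residue 1 modulo 5
      rules out two; a prime \<open>q\<close> other than 5 exists as n has at least two.\<close>
    obtain x where x: "[x = 1] (mod 5)" "[x = 0] (mod int q)"
      using crt[of 5 q 1 0] q by auto
    then have qx: "int q dvd x" by (simp add: cong_0_iff)
    have "\<not> 5 dvd x" using x(1) unfolding cong_def by presburger
    then have "\<not> int n dvd x" using c(2) by (metis dvd_trans int_dvd_int_iff of_nat_numeral)
    then have "\<not> signed_square_sum n k x" if "k < 2" for k
      using not_signed_square_sum_le_1 q qx that by blast
    moreover have "\<not> signed_square_sum n 2 x"
      using not_signed_square_sum_2_mod_5 c x by blast
    ultimately have lower: "\<not> signed_square_sum n k x" if "k < 3" for k
      using that by (metis less_Suc_eq numeral_3_eq_3 numeral_2_eq_2)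
    have d: "3 dvd n \<Longrightarrow> delta3 n = 0" using c delta3 by blast
    have "\<exists>k\<le>3. signed_square_sum n k y" for y
    \<comment> \<open>Three terms miss the multiples of 5, but these are reached with two.\<close>
    proof (cases "[y = 0] (mod 5)")
      case True
      then have "\<not> [y = 1] (mod 5) \<and> \<not> [y = -1] (mod 5)" by (simp add: cong_def)
      then have "signed_square_sum n 2 y" using signed_square_sum_2[OF assms(2)] d by blast
      then show ?thesis by (intro exI[of _ 2]) simp
    next
      case False
      then show ?thesis using signed_square_sum_3[OF assms(2)] by blast
    qed
    then show ?thesis using lower assms(1) by (intro diam_G_eqI[where x = x]) auto
  qed
  moreover have "diam_G n = ereal (real 4)" if c: "3 dvd n" "delta3 n = 1" "5 dvd n"
  proof -
    obtain q where q: "prime q" "q dvd n" "q > 3" "[q = 3] (mod 4)"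
      using c(2) by (auto simp: delta3_def split: if_splits)
    have "q \<noteq> 5" using q(4) by (auto simp: cong_def)
    then obtain y where y: "[y = 0] (mod 5)" "[y = 0] (mod int q)"
      using crt[of 5 q 0 0] q by auto
    have "coprime (3::int) (5 * int q)"
      using q primes_coprime[of 3 "int q"] primes_coprime[of "3::int" 5] by simp
    \<comment> \<open>The residue 0 modulo \<open>q\<close> rules out one term, together with 1
      modulo 3 also two terms, and 0 modulo 5 rules out three.\<close>
    then obtain x where x: "[x = 1] (mod 3)" "[x = 0] (mod (5 * int q))"
      using binary_chinese_remainder_int by blast
    then have qx: "int q dvd x" "5 dvd x" by (auto simp: cong_0_iff dest: dvd_mult_left dvd_mult_right)
    have "\<not> 3 dvd x" using x(1) unfolding cong_def by presburger
    then have "\<not> int n dvd x" using c(1) by (metis dvd_trans int_dvd_int_iff of_nat_numeral)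
    then have "\<not> signed_square_sum n k x" if "k < 2" for k
      using not_signed_square_sum_le_1 q qx that by blast
    moreover have "\<not> signed_square_sum n 2 x"
      using not_signed_square_sum_2_mod_3 c q x qx by blast
    moreover have "\<not> signed_square_sum n 3 x"
      using not_signed_square_sum_3_mod_5 c qx by blast
    moreover have "k < 2 \<or> k = 2 \<or> k = 3" if "k < 4" for k :: nat using that by linarith
    ultimately have "\<not> signed_square_sum n k x" if "k < 4" for k
      using that by metis
    then show ?thesis
      using signed_square_sum_4[OF assms(2)] assms(1)
      by (intro diam_G_eqI[where x = x]) auto
  qed
  ultimately show ?thesis using delta3 by (auto simp: gamma3_def gamma5_def)
qed

theorem theorem6:
  fixes n :: nat
  assumes "n > 1" and "odd n"
  shows "(prime n \<and> [n = 3] (mod 4) \<longrightarrow> diam_G n = 1)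
       \<and> (prime n \<and> [n = 1] (mod 4) \<longrightarrow> diam_G n = 2)
       \<and> (omega n = 1 \<and> \<not> prime n \<longrightarrow> diam_G n = 2)
       \<and> (omega n > 1 \<longrightarrow> diam_G n = ereal (real (2 + gamma3 n * delta3 n + gamma5 n)))
       \<and> diam_G n \<le> 4"
proof -
  have p3: "prime n \<and> [n = 3] (mod 4) \<longrightarrow> diam_G n = 1"
    using diam_G_prime_3_mod_4 by simp
  have p1: "prime n \<and> [n = 1] (mod 4) \<longrightarrow> diam_G n = 2"
    using diam_G_prime_1_mod_4 by simp
  have pp: "omega n = 1 \<and> \<not> prime n \<longrightarrow> diam_G n = 2"
    using diam_G_prime_power assms by simp
  have om: "omega n > 1 \<longrightarrow> diam_G n = ereal (real (2 + gamma3 n * delta3 n + gamma5 n))"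
    using diam_G_omega_gt_1 assms by blast
  have "2 + gamma3 n * delta3 n + gamma5 n \<le> 4"
    by (simp add: gamma3_def delta3_def gamma5_def)
  then have "ereal (real (2 + gamma3 n * delta3 n + gamma5 n)) \<le> 4"
    by (metis ereal_less_eq(3) numeral_eq_ereal of_nat_le_iff of_nat_numeral)
  then have "omega n > 1 \<longrightarrow> diam_G n \<le> 4" using om by simp
  \<comment> \<open>Since n > 1 has a prime factor and odd n is 1 or 3 modulo 4, the four cases are
    exhaustive and the bound 4 follows from them.\<close>
  moreover have "omega n \<noteq> 0"
    using assms(1) by (auto simp: omega_def prime_factorization_empty_iff)
  moreover have "n mod 4 = 1 \<or> n mod 4 = 3" using assms(2) by presburger
  then have "[n = 1] (mod 4) \<or> [n = 3] (mod 4)" by (simp add: cong_def)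
  ultimately consider "diam_G n \<le> 4" | "diam_G n = 1" | "diam_G n = 2"
    using p3 p1 pp by (cases "omega n > 1"; cases "prime n") auto
  then have "diam_G n \<le> 4" by cases auto
  with p3 p1 pp om show ?thesis by blast
qed

end
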